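(* Let $f:\mathbb{R}^n\to\mathbb{R}$ be differentiable, with gradient Lipschitz constant $L_1(f)>0$, i.e. $\|\nabla f(x)-\nabla f(y)\|\le L_1(f)\|x-y\|$ for all $x,y\in\mathbb{R}^n$. Assume that $f$ is bounded below, and that $f$ satisfies the Polyak-Łojasiewicz condition with constant $l>0$, i.e. $\frac12\|\nabla f(x)\|^2\ge l\,(f(x)-f^\ast)$ for all $x\in\mathbb{R}^n$, where $f^\ast=f(x^\ast)$ is the minimum value of $f$ over $\mathbb{R}^n$. Let $\mu>0$, $x_0\in\mathbb{R}^n$, and let $\{x_k\}_{k\ge 0}$ be the random sequence generated by $x_{k+1}=x_k-h_k\,g_\mu(x_k)$, where $g_\mu(x_k)=\frac{f(x_k+\mu u_k)-f(x_k)}{\mu}Bu_k$ is the Gaussian random oracle evaluated with the $k$-th random vector $u_k$, and with step size $h_k=\frac{1}{4(n+4)L_1(f)}$ for all $k$. Then, for any integer $N\ge 0$, $$\frac{1}{N+1}\sum_{k=0}^{N}(\Phi_k-f^\ast)\le \frac{8(n+4)L_1(f)}{l}\left[\frac{f(x_0)-f^\ast}{N+1}+\frac{3\mu^2(n+4)}{32}L_1(f)\right]+\frac{\mu^2}{4l}L_1(f)^2(n+6)^3,$$ where $\Phi_0=f(x_0)$ and $\Phi_k=E_{\mathcal{U}_k}[f(x_k)]$ for $k\ge 1$, with $\mathcal{U}_k=\{u_0,u_1,\dots,u_{k-1}\}$.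
   Context: $\|\cdot\|$ is the Euclidean norm. The vectors $u_0,u_1,\dots$ are independent zero-mean Gaussian vectors in $\mathbb{R}^n$ with positive definite correlation operator $B^{-1}$, having density $\frac1\kappa e^{-\frac12\|u\|^2}$ with respect to Lebesgue measure, where $\kappa=\int_{\mathbb{R}^n} e^{-\frac12\|u\|^2}\,\mathrm{d}u=\frac{(2\pi)^{n/2}}{(\det B)^{1/2}}$ (with the Euclidean norm these conventions mean that $B$ is the identity matrix). $E_{\mathcal{U}_k}$ denotes expectation over $u_0,\dots,u_{k-1}$; note that $x_k$ is a function of $x_0$ and $u_0,\dots,u_{k-1}$. The parameter $\mu>0$ is the smoothing parameter of the oracle. *)

theory Defs
  imports "HOL-Probability.Probability"
begin

definition positive_definite :: "real^'n^'n \<Rightarrow> bool" where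
  "positive_definite A \<longleftrightarrow> transpose A = A \<and> (\<forall>v. v \<noteq> 0 \<longrightarrow> v \<bullet> (A *v v) > 0)"

definition gaussian_density :: "real^'n \<Rightarrow> real" where
  "gaussian_density v =
     (1 / (LINT w|lborel. exp (- (1/2) * (norm (w::real^'n))\<^sup>2))) * exp (- (1/2) * (norm v)\<^sup>2)"

(* The density is written with the Euclidean norm, so the last two conjuncts together
   force B to be the identity matrix. B is kept as a parameter because the oracle below
   is written in terms of it. *)
definition gaussian_vector :: "'w measure \<Rightarrow> real^'n^'n \<Rightarrow> ('w \<Rightarrow> real^'n) \<Rightarrow> bool" where
  "gaussian_vector M B X \<longleftrightarrow>
     invertible B \<and> positive_definite (matrix_inv B) \<and>
     integral\<^sup>L M X = 0 \<and>
     (\<chi> i j. integral\<^sup>L M (\<lambda>\<omega>. X \<omega> $ i * X \<omega> $ j)) = matrix_inv B \<and>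
     distributed M lborel X (\<lambda>v. ennreal (gaussian_density v))"

definition gaussian_oracle ::
  "real^'n^'n \<Rightarrow> real \<Rightarrow> (real^'n \<Rightarrow> real) \<Rightarrow> real^'n \<Rightarrow> real^'n \<Rightarrow> real^'n" where
  "gaussian_oracle B \<mu> f x u = ((f (x + \<mu> *\<^sub>R u) - f x) / \<mu>) *\<^sub>R (B *v u)"

primrec rand_iterate ::
  "real^'n^'n \<Rightarrow> real \<Rightarrow> (real^'n \<Rightarrow> real) \<Rightarrow> (nat \<Rightarrow> real) \<Rightarrow> real^'n \<Rightarrow> (nat \<Rightarrow> real^'n) \<Rightarrow> nat \<Rightarrow> real^'n"
where
  "rand_iterate B \<mu> f h x0 u 0 = x0"
| "rand_iterate B \<mu> f h x0 u (Suc k) =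
     rand_iterate B \<mu> f h x0 u k
       - h k *\<^sub>R gaussian_oracle B \<mu> f (rand_iterate B \<mu> f h x0 u k) (u k)"

(* The k-th iterate depends on u only through u 0, ..., u (k - 1), so integrating over
   the whole probability space M is the expectation over these k vectors. *)
definition expected_value ::
  "'w measure \<Rightarrow> (nat \<Rightarrow> 'w \<Rightarrow> real^'n) \<Rightarrow> real^'n^'n \<Rightarrow> real \<Rightarrow> (real^'n \<Rightarrow> real)
    \<Rightarrow> (nat \<Rightarrow> real) \<Rightarrow> real^'n \<Rightarrow> nat \<Rightarrow> real" where
  "expected_value M u B \<mu> f h x0 k =
     (if k = 0 then f x0
      else integral\<^sup>L M (\<lambda>\<omega>. f (rand_iterate B \<mu> f h x0 (\<lambda>i. u i \<omega>) k)))"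

end

theory Submission
  imports Defs
begin

text \<open>
  The usual analysis of this method follows the smoothed function
  \<open>x \<mapsto> E f(x + \<mu> u)\<close>.  The proof below measures progress on \<^term>\<open>f\<close> itself, which
  leaves room in every constant of the claim.

  Write \<open>g\<close> for the gradient at the current point, \<open>a = g \<bullet> u\<close>, and \<open>d\<close> for the difference
  quotient \<open>(f(x + \<mu> u) - f(x)) / \<mu>\<close>.  Since the gradient is Lipschitz, \<open>d\<close> differs from \<open>a\<close>
  by at most \<open>\<mu> L \<parallel>u\<parallel>\<^sup>2 / 2\<close>, and \<open>f\<close> lies below its quadratic upper model.  The step
  \<open>- h d u\<close> therefore decreases \<open>f\<close> by about \<open>h a\<^sup>2\<close>, up to terms in \<open>a\<^sup>2 \<parallel>u\<parallel>\<^sup>2\<close>, \<open>\<parallel>u\<parallel>\<^sup>4\<close>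
  and \<open>\<parallel>u\<parallel>\<^sup>6\<close> (\<open>oracle_step_upper_bound\<close>).  The Gaussian moments of these polynomials are
  \<open>\<parallel>g\<parallel>\<^sup>2\<close>, \<open>(n + 2) \<parallel>g\<parallel>\<^sup>2\<close>, \<open>n (n + 2)\<close> and \<open>n (n + 2) (n + 4)\<close>, so with
  \<open>h = 1 / (4 (n + 4) L)\<close> the expected decrease is at least \<open>h \<parallel>g\<parallel>\<^sup>2 / 2 - 5/16 h \<mu>\<^sup>2 L\<^sup>2 n (n + 2)\<close>
  (\<open>expected_step_upper_bound\<close>).

  By the Polyak-Lojasiewicz inequality \<open>\<parallel>g\<parallel>\<^sup>2 / 2\<close> dominates \<open>l\<close> times the optimality gap.  As the
  \<open>k\<close>-th iterate is independent of the \<open>k\<close>-th direction, the expected gaps \<open>e\<^sub>k\<close> satisfy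
  \<open>e\<^sub>k\<^sub>+\<^sub>1 + h l e\<^sub>k \<le> e\<^sub>k + 5/16 h \<mu>\<^sup>2 L\<^sup>2 n (n + 2)\<close> (\<open>expected_gap_recursion\<close>).  Summing over
  \<open>k\<close> telescopes and gives
  \<open>4 (n + 4) L / l \<cdot> e\<^sub>0 / (N + 1) + 5/16 \<mu>\<^sup>2 L\<^sup>2 n (n + 2) / l\<close> as a bound for the average gap; the
  claimed bound is larger term by term.
\<close>

section \<open>Moments of the standard Gaussian measure\<close>

definition gaussian_measure :: "(real^'n) measure" where
  "gaussian_measure = density lborel (\<lambda>v. ennreal (gaussian_density v))"

definition normal_moment :: "nat \<Rightarrow> real" where
  "normal_moment k = (LINT x|lborel. std_normal_density x * x ^ k)"

definition monomial :: "('n::finite \<Rightarrow> nat) \<Rightarrow> real^'n \<Rightarrow> real" where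
  "monomial m v = (\<Prod>i\<in>UNIV. (v $ i) ^ m i)"

text \<open>Lebesgue measure on \<^typ>\<open>real^'n\<close> is the image of a product measure, so Fubini applies
  to functions that factor over the coordinates.\<close>
lemma has_bochner_integral_prod_components:
  fixes q :: "'n::finite \<Rightarrow> real \<Rightarrow> real"
  assumes q: "\<And>i. integrable lborel (q i)"
  shows "has_bochner_integral lborel (\<lambda>v::real^'n. \<Prod>i\<in>UNIV. q i (v $ i))
           (\<Prod>i\<in>UNIV. LINT x|lborel. q i x)"
proof -
  interpret product_sigma_finite "\<lambda>_::real^'n. lborel :: real measure" ..
  have inj: "inj (\<lambda>i::'n. axis i (1::real))"
    by (auto simp: inj_on_def axis_eq_axis)
  have Basis: "(Basis :: (real^'n) set) = range (\<lambda>i. axis i 1)"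
    by (auto simp: Basis_vec_def)
  \<comment> \<open>The family \<open>q\<close>, reindexed by the basis vectors \<open>axis i 1\<close>.\<close>
  define r where "r b = q (inv (\<lambda>i::'n. axis i (1::real)) b)" for b
  have r: "r (axis i 1) = q i" for i
    by (simp add: r_def inv_f_f[OF inj])
  have prod_reindex: "(\<Prod>b\<in>Basis. G b) = (\<Prod>i\<in>UNIV. G (axis i 1))" for G :: "real^'n \<Rightarrow> real"
    unfolding Basis using inj by (subst prod.reindex) auto
  have int: "integrable lborel (r b)" if "b \<in> Basis" for b
    using that q by (auto simp: Basis r)
  have q_meas [measurable]: "q i \<in> borel_measurable borel" for i
    using q[of i] by auto
  have eq: "(\<Prod>i\<in>UNIV. q i ((\<Sum>b\<in>Basis. w b *\<^sub>R b) $ i)) = (\<Prod>b\<in>Basis. r b (w b))" for w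
  proof -
    have "(\<Sum>b\<in>Basis. w b *\<^sub>R b) $ i = w (axis i 1)" for i
    proof -
      have "(\<Sum>b\<in>Basis. w b *\<^sub>R b) $ i = (\<Sum>b\<in>Basis. w b *\<^sub>R b) \<bullet> axis i 1"
        by (simp add: cart_eq_inner_axis)
      also have "\<dots> = w (axis i 1)"
        by (rule inner_sum_left_Basis) simp
      finally show ?thesis .
    qed
    then show ?thesis by (simp add: prod_reindex r)
  qed
  have "has_bochner_integral (\<Pi>\<^sub>M b\<in>(Basis::(real^'n) set). lborel)
          (\<lambda>w. \<Prod>b\<in>Basis. r b (w b)) (\<Prod>b\<in>Basis. LINT x|lborel. r b x)"
    using product_integrable_prod[OF finite_Basis int] product_integral_prod[OF finite_Basis int]
    by (simp add: has_bochner_integral_iff)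
  then have "has_bochner_integral (\<Pi>\<^sub>M b\<in>(Basis::(real^'n) set). lborel)
          (\<lambda>w. \<Prod>i\<in>UNIV. q i ((\<Sum>b\<in>Basis. w b *\<^sub>R b) $ i)) (\<Prod>i\<in>UNIV. LINT x|lborel. q i x)"
    by (simp only: eq) (simp add: prod_reindex r)
  then show ?thesis
    unfolding lborel_eq[where 'a = "real^'n"]
    by (intro has_bochner_integral_distr) auto
qed

text \<open>Under the Gaussian measure the coordinates are independent standard normal variables.
  The normalising integral in the definition of the density takes the value that makes each
  factor a normalised normal density.\<close>
lemma gaussian_density_eq_prod:
  "gaussian_density (v :: real^'n) = (\<Prod>i\<in>UNIV. std_normal_density (v $ i))"
proof -
  have exp_prod: "exp (- (1/2) * (norm w)\<^sup>2) = sqrt (2 * pi) ^ CARD('n) * (\<Prod>i\<in>UNIV. std_normal_density (w $ i))"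
    for w :: "real^'n"
  proof -
    have "exp (- (1/2) * (norm w)\<^sup>2) = exp (\<Sum>i\<in>UNIV. - (w $ i)\<^sup>2 / 2)"
      by (simp add: norm_vec_def L2_set_def sum_nonneg sum_distrib_left sum_negf sum_divide_distrib)
    also have "\<dots> = (\<Prod>i\<in>UNIV. sqrt (2 * pi) * std_normal_density (w $ i))"
      by (simp add: exp_sum std_normal_density_def)
    finally show ?thesis
      by (simp add: prod.distrib)
  qed
  have "has_bochner_integral lborel (\<lambda>w::real^'n. \<Prod>i\<in>UNIV. std_normal_density (w $ i))
          (\<Prod>i\<in>(UNIV::'n set). LINT x|lborel. std_normal_density x)"
    by (intro has_bochner_integral_prod_components) simp
  then have "(LINT w|lborel. exp (- (1/2) * (norm (w::real^'n))\<^sup>2)) = sqrt (2 * pi) ^ CARD('n)"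
    unfolding exp_prod by (simp add: has_bochner_integral_iff)
  then show ?thesis
    unfolding gaussian_density_def exp_prod by simp
qed

lemma gaussian_density_nonneg: "0 \<le> gaussian_density (v :: real^'n)"
  unfolding gaussian_density_eq_prod by (intro prod_nonneg) simp

lemma gaussian_density_measurable [measurable]:
  "gaussian_density \<in> borel_measurable (borel :: (real^'n) measure)"
  unfolding gaussian_density_eq_prod by measurable

lemma sets_gaussian_measure [simp, measurable_cong]: "sets gaussian_measure = sets borel"
  by (simp add: gaussian_measure_def)

lemma has_bochner_integral_monomial:
  "has_bochner_integral gaussian_measure (monomial m :: real^'n \<Rightarrow> real)
     (\<Prod>i\<in>UNIV. normal_moment (m i))"
proof -
  have "has_bochner_integral lborel
          (\<lambda>v::real^'n. \<Prod>i\<in>UNIV. std_normal_density (v $ i) * (v $ i) ^ m i)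
          (\<Prod>i\<in>UNIV. normal_moment (m i))"
    unfolding normal_moment_def
    by (intro has_bochner_integral_prod_components integrable_std_normal_moment)
  then have "has_bochner_integral lborel
          (\<lambda>v::real^'n. gaussian_density v *\<^sub>R monomial m v) (\<Prod>i\<in>UNIV. normal_moment (m i))"
    by (simp add: gaussian_density_eq_prod monomial_def prod.distrib)
  then show ?thesis
    unfolding gaussian_measure_def
    by (intro has_bochner_integral_density) (auto simp: gaussian_density_nonneg monomial_def[abs_def])
qed

lemma normal_moment_add_2: "normal_moment (k + 2) = (real k + 1) * normal_moment k"
proof (cases "even k")
  case True
  then obtain j where j: "k = 2 * j" by blast
  have "normal_moment (k + 2) = fact (2 * Suc j) / (2 ^ Suc j * fact (Suc j))"
    unfolding normal_moment_def j using integral_std_normal_moment_even[of "Suc j"] by simp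
  also have "fact (2 * Suc j) = 2 * (real j + 1) * (2 * real j + 1) * fact (2 * j)"
    by (simp add: algebra_simps)
  also have "\<dots> / (2 ^ Suc j * fact (Suc j)) = (2 * real j + 1) * (fact (2 * j) / (2 ^ j * fact j))"
    by (simp add: divide_simps)
  also have "\<dots> = (real k + 1) * normal_moment k"
    unfolding normal_moment_def j by (simp only: integral_std_normal_moment_even) simp
  finally show ?thesis .
next
  case False
  then obtain j where j: "k = 2 * j + 1" by (rule oddE)
  then have "k + 2 = 2 * Suc j + 1" by simp
  then show ?thesis
    unfolding normal_moment_def j by (simp only: integral_std_normal_moment_odd)
qed

lemma normal_moment_0: "normal_moment 0 = 1"
  using integral_std_normal_moment_even[of 0] by (simp add: normal_moment_def)

lemma normal_moment_1: "normal_moment (Suc 0) = 0"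
  using integral_std_normal_moment_odd[of 0] by (simp add: normal_moment_def)

lemma normal_moment_2: "normal_moment 2 = 1"
  using normal_moment_add_2[of 0] by (simp add: normal_moment_0 numeral_2_eq_2)

lemma norm_sq_vec: "(norm (v :: real^'n))\<^sup>2 = (\<Sum>i\<in>UNIV. (v $ i)\<^sup>2)"
  by (simp add: norm_vec_def L2_set_def sum_nonneg)

text \<open>The one-dimensional recursion \<open>E x\<^sup>k\<^sup>+\<^sup>2 = (k + 1) E x\<^sup>k\<close>, applied in each coordinate, says that
  an additional factor \<open>(v $ i)\<^sup>2\<close> multiplies the expectation of a monomial by \<open>m i + 1\<close>.
  Adding up over the coordinates, a factor \<open>\<parallel>v\<parallel>\<^sup>2\<close> multiplies it by the dimension plus the degree.\<close>
lemma has_bochner_integral_monomial_norm_sq: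
  fixes m :: "'n::finite \<Rightarrow> nat"
  shows "has_bochner_integral gaussian_measure (\<lambda>v::real^'n. monomial m v * (norm v)\<^sup>2)
     ((real CARD('n) + real (\<Sum>i\<in>UNIV. m i)) * (\<Prod>i\<in>UNIV. normal_moment (m i)))"
proof -
  define m2 where "m2 k = m(k := m k + 2)" for k
  have mon: "monomial m v * (v $ k)\<^sup>2 = monomial (m2 k) v" for k and v :: "real^'n"
    unfolding monomial_def m2_def
    by (simp add: prod.remove[of UNIV k] power_add power2_eq_square)
  have mom: "(\<Prod>i\<in>UNIV. normal_moment (m2 k i)) = (real (m k) + 1) * (\<Prod>i\<in>UNIV. normal_moment (m i))" for k
    unfolding m2_def using normal_moment_add_2[of "m k"]
    by (simp add: prod.remove[of UNIV k])
  have "has_bochner_integral gaussian_measure (\<lambda>v::real^'n. \<Sum>k\<in>UNIV. monomial (m2 k) v)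
          (\<Sum>k\<in>UNIV. \<Prod>i\<in>UNIV. normal_moment (m2 k i))"
    by (intro has_bochner_integral_sum has_bochner_integral_monomial)
  moreover have "(\<Sum>k\<in>UNIV. monomial (m2 k) v) = monomial m v * (norm v)\<^sup>2" for v :: "real^'n"
    by (simp add: norm_sq_vec sum_distrib_left mon)
  moreover have "(\<Sum>k\<in>UNIV. \<Prod>i\<in>UNIV. normal_moment (m2 k i))
      = (real CARD('n) + real (\<Sum>i\<in>UNIV. m i)) * (\<Prod>i\<in>UNIV. normal_moment (m i))"
    by (simp add: mom sum.distrib flip: sum_distrib_right)
  ultimately show ?thesis by simp
qed

text \<open>The factor found for monomials depends only on the degree, so it is the same for all
  homogeneous polynomials of degree \<open>d\<close>.  This reduces the moments of degree four and six
  to the covariance.\<close>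
lemma has_bochner_integral_homogeneous_norm_sq:
  fixes p :: "real^'n \<Rightarrow> real" and m :: "'s \<Rightarrow> 'n \<Rightarrow> nat"
  assumes p: "\<And>v. p v = (\<Sum>s\<in>S. c s * monomial (m s) v)"
    and degree: "\<And>s. s \<in> S \<Longrightarrow> (\<Sum>i\<in>UNIV. m s i) = d"
    and e: "has_bochner_integral gaussian_measure p e"
  shows "has_bochner_integral gaussian_measure (\<lambda>v. p v * (norm v)\<^sup>2) ((real CARD('n) + real d) * e)"
proof -
  have "has_bochner_integral gaussian_measure p (\<Sum>s\<in>S. c s * (\<Prod>i\<in>UNIV. normal_moment (m s i)))"
    unfolding p[abs_def]
    by (intro has_bochner_integral_sum has_bochner_integral_mult_right has_bochner_integral_monomial)
  with e have e_eq: "e = (\<Sum>s\<in>S. c s * (\<Prod>i\<in>UNIV. normal_moment (m s i)))"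
    by (rule has_bochner_integral_eq)
  have "has_bochner_integral gaussian_measure
          (\<lambda>v. \<Sum>s\<in>S. c s * (monomial (m s) v * (norm v)\<^sup>2))
          (\<Sum>s\<in>S. c s * ((real CARD('n) + real (\<Sum>i\<in>UNIV. m s i)) * (\<Prod>i\<in>UNIV. normal_moment (m s i))))"
    by (intro has_bochner_integral_sum has_bochner_integral_mult_right
        has_bochner_integral_monomial_norm_sq)
  moreover have "(\<Sum>s\<in>S. c s * (monomial (m s) v * (norm v)\<^sup>2)) = p v * (norm v)\<^sup>2" for v
    by (simp add: p sum_distrib_right mult.assoc)
  moreover have "(\<Sum>s\<in>S. c s * ((real CARD('n) + real (\<Sum>i\<in>UNIV. m s i)) * (\<Prod>i\<in>UNIV. normal_moment (m s i))))
      = (real CARD('n) + real d) * e"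
    unfolding e_eq sum_distrib_left by (intro sum.cong refl) (simp add: degree)
  ultimately show ?thesis by simp
qed

text \<open>The sum makes the case \<open>i = j\<close> the exponent of the square \<open>(v $ i)\<^sup>2\<close>.\<close>
definition pair_exponents :: "'n \<Rightarrow> 'n \<Rightarrow> 'n::finite \<Rightarrow> nat" where
  "pair_exponents i j = (\<lambda>a. of_bool (a = i) + of_bool (a = j))"

lemma power_of_bool: "x ^ of_bool P = (if P then x else (1::real))"
  by simp

lemma monomial_pair: "monomial (pair_exponents i j) = (\<lambda>v. v $ i * v $ j)"
  by (rule ext) (simp add: monomial_def pair_exponents_def power_add prod.distrib power_of_bool)

lemma degree_pair: "(\<Sum>a\<in>UNIV. pair_exponents i j a) = 2"
  by (simp add: pair_exponents_def sum.distrib of_bool_def)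

lemma has_bochner_integral_pair:
  "has_bochner_integral gaussian_measure (\<lambda>v::real^'n. v $ i * v $ j) (if i = j then 1 else 0)"
proof -
  have "(\<Prod>a\<in>UNIV. normal_moment (pair_exponents i j a)) = (if i = j then 1 else 0)"
  proof (cases "i = j")
    case True
    then have "normal_moment (pair_exponents i j a) = 1" for a
      by (auto simp: pair_exponents_def normal_moment_0 normal_moment_2[unfolded numeral_2_eq_2])
    with True show ?thesis by simp
  next
    case False
    then have "normal_moment (pair_exponents i j i) = 0"
      by (simp add: pair_exponents_def normal_moment_1)
    with False show ?thesis by (simp add: prod_zero_iff) blast
  qed
  with has_bochner_integral_monomial[of "pair_exponents i j"] show ?thesis
    by (simp only: monomial_pair)
qed

lemma inner_sq_sum: "(g \<bullet> v)\<^sup>2 = (\<Sum>(i,j)\<in>UNIV. g $ i * g $ j * (v $ i * v $ j))"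
  for g v :: "real^'n"
  by (simp add: inner_vec_def power2_eq_square sum_product sum.cartesian_product mult_ac)

lemma expectation_inner_sq:
  "has_bochner_integral gaussian_measure (\<lambda>v::real^'n. (g \<bullet> v)\<^sup>2) ((norm g)\<^sup>2)"
proof -
  have "has_bochner_integral gaussian_measure (\<lambda>v::real^'n. (g \<bullet> v)\<^sup>2)
     (\<Sum>(i,j)\<in>UNIV. g $ i * g $ j * (if i = j then 1 else 0))"
    unfolding inner_sq_sum case_prod_unfold
    by (intro has_bochner_integral_sum has_bochner_integral_mult_right has_bochner_integral_pair)
  moreover have "(\<Sum>(i,j)\<in>UNIV. g $ i * g $ j * (if i = j then 1 else 0)) = (norm g)\<^sup>2"
    by (simp add: norm_sq_vec if_distrib flip: UNIV_Times_UNIV sum.cartesian_product power2_eq_square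
        cong: if_cong)
  ultimately show ?thesis by simp
qed

lemma expectation_inner_sq_norm_sq:
  "has_bochner_integral gaussian_measure (\<lambda>v::real^'n. (g \<bullet> v)\<^sup>2 * (norm v)\<^sup>2)
     ((real CARD('n) + 2) * (norm g)\<^sup>2)"
  using has_bochner_integral_homogeneous_norm_sq[where S = UNIV and d = 2
      and c = "\<lambda>(i,j). g $ i * g $ j" and m = "\<lambda>(i,j). pair_exponents i j",
      OF _ _ expectation_inner_sq[of g]]
  by (simp add: inner_sq_sum case_prod_unfold monomial_pair degree_pair)

text \<open>\<open>\<parallel>v\<parallel>\<^sup>4\<close> is the sum of \<open>(g \<bullet> v)\<^sup>2 \<parallel>v\<parallel>\<^sup>2\<close> over the standard basis vectors \<open>g\<close>.\<close>
lemma expectation_norm_pow_4: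
  "has_bochner_integral gaussian_measure (\<lambda>v::real^'n. (norm v) ^ 4)
     (real CARD('n) * (real CARD('n) + 2))"
proof -
  have "has_bochner_integral gaussian_measure (\<lambda>v::real^'n. \<Sum>i\<in>UNIV. (axis i 1 \<bullet> v)\<^sup>2 * (norm v)\<^sup>2)
     (\<Sum>i\<in>(UNIV::'n set). (real CARD('n) + 2) * (norm (axis i 1 :: real^'n))\<^sup>2)"
    by (intro has_bochner_integral_sum expectation_inner_sq_norm_sq)
  moreover have "(\<Sum>i\<in>UNIV. (axis i 1 \<bullet> v)\<^sup>2 * (norm v)\<^sup>2) = norm v ^ 4" for v :: "real^'n"
    by (simp add: norm_sq_vec inner_axis' flip: sum_distrib_right)
      (simp flip: norm_sq_vec power_add power2_eq_square)
  ultimately show ?thesis by simp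
qed

text \<open>\<open>\<parallel>v\<parallel>\<^sup>4\<close> is a sum of monomials \<open>(v $ i)\<^sup>2 (v $ j)\<^sup>2\<close>, homogeneous of degree four, so one more
  factor \<open>\<parallel>v\<parallel>\<^sup>2\<close> contributes \<open>n + 4\<close>.\<close>
lemma expectation_norm_pow_6:
  "has_bochner_integral gaussian_measure (\<lambda>v::real^'n. (norm v) ^ 6)
     (real CARD('n) * (real CARD('n) + 2) * (real CARD('n) + 4))"
proof -
  define m :: "'n \<times> 'n \<Rightarrow> 'n \<Rightarrow> nat" where
    "m s a = pair_exponents (fst s) (fst s) a + pair_exponents (snd s) (snd s) a" for s a
  have mon: "monomial (m s) v = (v $ fst s)\<^sup>2 * (v $ snd s)\<^sup>2" for s v
    using fun_cong[OF monomial_pair, of "fst s" "fst s" v] fun_cong[OF monomial_pair, of "snd s" "snd s" v]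
    by (simp add: monomial_def m_def power_add prod.distrib power2_eq_square)
  have pow4: "norm v ^ 4 = (\<Sum>s\<in>UNIV. 1 * monomial (m s) v)" for v
  proof -
    have "norm v ^ 4 = (norm v)\<^sup>2 * (norm v)\<^sup>2" by (simp flip: power_add)
    then show ?thesis
      by (simp add: norm_sq_vec sum_product sum.cartesian_product mon case_prod_unfold)
  qed
  have "(\<Sum>a\<in>UNIV. m s a) = 4" for s
    by (simp add: m_def sum.distrib degree_pair)
  from has_bochner_integral_homogeneous_norm_sq[OF pow4 this expectation_norm_pow_4]
  show ?thesis by (simp add: mult_ac flip: power_add)
qed

section \<open>Descent along a random direction\<close>

text \<open>Along the segment from \<open>x\<close> to \<open>y\<close> the slope of \<open>f\<close> exceeds its initial value by at most
  \<open>L t \<parallel>y - x\<parallel>\<^sup>2\<close> at time \<open>t\<close>.  Subtracting the quadratic model from \<open>f\<close> therefore leaves a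
  function that is nonincreasing on the segment.\<close>
lemma lipschitz_gradient_upper_bound:
  fixes f :: "'a::real_inner \<Rightarrow> real"
  assumes f: "\<And>x. GDERIV f x :> grad x"
    and lip: "L-lipschitz_on UNIV grad"
  shows "f y \<le> f x + grad x \<bullet> (y - x) + L / 2 * (norm (y - x))\<^sup>2"
proof -
  define w where "w = y - x"
  define q where "q t = f (x + t *\<^sub>R w) - t * (grad x \<bullet> w) - L / 2 * t\<^sup>2 * (norm w)\<^sup>2" for t :: real
  have "q 1 \<le> q 0"
  proof (rule DERIV_nonpos_imp_nonincreasing[where f = q and a = 0 and b = 1])
    fix t :: real
    assume t: "0 \<le> t" "t \<le> 1"
    have f': "(f has_derivative (\<lambda>z. z \<bullet> grad (x + t *\<^sub>R w))) (at (x + t *\<^sub>R w))"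
      using f by (simp add: gderiv_def)
    have "((\<lambda>t. x + t *\<^sub>R w) has_derivative (\<lambda>s. s *\<^sub>R w)) (at t)"
      by (auto intro!: derivative_eq_intros)
    from has_derivative_compose[OF this f']
    have "((\<lambda>t. f (x + t *\<^sub>R w)) has_real_derivative w \<bullet> grad (x + t *\<^sub>R w)) (at t)"
      by (simp add: has_field_derivative_def mult_commute_abs)
    then have "(q has_real_derivative
        w \<bullet> grad (x + t *\<^sub>R w) - grad x \<bullet> w - L * t * (norm w)\<^sup>2) (at t)"
      unfolding q_def[abs_def] by (auto intro!: derivative_eq_intros)
    moreover have "w \<bullet> grad (x + t *\<^sub>R w) - grad x \<bullet> w - L * t * (norm w)\<^sup>2 \<le> 0"
    proof -
      have "w \<bullet> grad (x + t *\<^sub>R w) - grad x \<bullet> w = (grad (x + t *\<^sub>R w) - grad x) \<bullet> w"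
        by (simp add: inner_diff_left inner_commute[of w])
      also have "\<dots> \<le> norm (grad (x + t *\<^sub>R w) - grad x) * norm w"
        by (rule norm_cauchy_schwarz)
      also have "\<dots> \<le> (L * (t * norm w)) * norm w"
        using lipschitz_onD[OF lip, of "x + t *\<^sub>R w" x] t
        by (intro mult_right_mono) (auto simp: dist_norm)
      finally show ?thesis by (simp add: power2_eq_square mult_ac)
    qed
    ultimately show "\<exists>d. (q has_real_derivative d) (at t) \<and> d \<le> 0" by blast
  qed simp
  then show ?thesis by (simp add: q_def w_def)
qed

text \<open>The matching lower bound is the upper bound for \<open>- f\<close>.\<close>
lemma lipschitz_gradient_linear_approximation:
  fixes f :: "'a::real_inner \<Rightarrow> real"
  assumes f: "\<And>x. GDERIV f x :> grad x"
    and lip: "L-lipschitz_on UNIV grad"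
  shows "\<bar>f y - f x - grad x \<bullet> (y - x)\<bar> \<le> L / 2 * (norm (y - x))\<^sup>2"
proof -
  have "L-lipschitz_on UNIV (\<lambda>x. - grad x)"
    using lip by (simp add: lipschitz_on_def dist_minus)
  from lipschitz_gradient_upper_bound[OF GDERIV_minus[OF f] this, of y x]
    lipschitz_gradient_upper_bound[OF f lip, of y x]
  show ?thesis unfolding inner_minus_left by linarith
qed

text \<open>The quadratic upper model gives \<open>f(x) - \<eta> d a + L \<eta>\<^sup>2 d\<^sup>2 \<parallel>v\<parallel>\<^sup>2 / 2\<close> for the difference quotient
  \<open>d = a + r\<close>, with \<open>a = grad x \<bullet> v\<close> and an error \<open>\<bar>r\<bar> \<le> L \<mu> \<parallel>v\<parallel>\<^sup>2 / 2\<close>.  The product \<open>d a\<close> gives up a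
  quarter of \<open>a\<^sup>2\<close> to absorb \<open>r\<close>.  The bound is a polynomial in \<open>v\<close>, so its Gaussian expectation
  can be computed exactly.\<close>
lemma oracle_step_upper_bound:
  fixes f :: "real^'n \<Rightarrow> real" and v :: "real^'n"
  assumes f: "\<And>x. GDERIV f x :> grad x"
    and lip: "L-lipschitz_on UNIV grad"
    and pos: "\<mu> > 0" "\<eta> \<ge> 0"
  shows "f (x - \<eta> *\<^sub>R gaussian_oracle (mat 1) \<mu> f x v)
    \<le> f x - 3/4 * \<eta> * (grad x \<bullet> v)\<^sup>2 + L * \<eta>\<^sup>2 * ((grad x \<bullet> v)\<^sup>2 * (norm v)\<^sup>2)
        + \<eta> * \<mu>\<^sup>2 * L\<^sup>2 / 4 * norm v ^ 4 + \<eta>\<^sup>2 * \<mu>\<^sup>2 * L ^ 3 / 4 * norm v ^ 6"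
proof -
  define a where "a = grad x \<bullet> v"
  define s where "s = (norm v)\<^sup>2"
  define d where "d = (f (x + \<mu> *\<^sub>R v) - f x) / \<mu>"
  define r where "r = d - a"
  have L: "L \<ge> 0" using lip by (rule lipschitz_on_nonneg)
  have s: "s \<ge> 0" by (simp add: s_def)
  have "\<bar>\<mu> * d - \<mu> * a\<bar> \<le> L / 2 * (\<mu>\<^sup>2 * s)"
    using lipschitz_gradient_linear_approximation[OF f lip, of "x + \<mu> *\<^sub>R v" x] pos
    by (simp add: d_def a_def s_def power_mult_distrib)
  moreover have "\<mu> * d - \<mu> * a = \<mu> * r" by (simp add: r_def right_diff_distrib)
  ultimately have "\<mu> * \<bar>r\<bar> \<le> \<mu> * (L * \<mu> * s / 2)"
    using pos by (simp add: power2_eq_square abs_mult mult_ac)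
  then have "\<bar>r\<bar> \<le> L * \<mu> * s / 2" using pos by simp
  then have "r\<^sup>2 \<le> (L * \<mu> * s / 2)\<^sup>2" by (simp add: abs_le_square_iff[symmetric])
  then have r: "r\<^sup>2 \<le> L\<^sup>2 * \<mu>\<^sup>2 / 4 * s\<^sup>2" by (simp add: power_divide power_mult_distrib)
  have "f (x - \<eta> *\<^sub>R gaussian_oracle (mat 1) \<mu> f x v) \<le> f x - \<eta> * d * a + L / 2 * (\<eta>\<^sup>2 * d\<^sup>2 * s)"
    using lipschitz_gradient_upper_bound[OF f lip, of "x - \<eta> *\<^sub>R gaussian_oracle (mat 1) \<mu> f x v" x]
    by (simp add: gaussian_oracle_def d_def[symmetric] a_def s_def power_mult_distrib)
  also have "\<dots> \<le> f x - \<eta> * (3/4 * a\<^sup>2 - r\<^sup>2) + L / 2 * (\<eta>\<^sup>2 * (2 * a\<^sup>2 + 2 * r\<^sup>2) * s)"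
  proof -
    \<comment> \<open>\<open>d a - (3/4 a\<^sup>2 - r\<^sup>2)\<close> and \<open>2 a\<^sup>2 + 2 r\<^sup>2 - d\<^sup>2\<close> are perfect squares.\<close>
    have "0 \<le> (a / 2 + r)\<^sup>2" by simp
    then have "3/4 * a\<^sup>2 - r\<^sup>2 \<le> d * a"
      by (simp add: r_def power2_eq_square algebra_simps)
    moreover have "0 \<le> (a - r)\<^sup>2" by simp
    then have "d\<^sup>2 \<le> 2 * a\<^sup>2 + 2 * r\<^sup>2"
      by (simp add: r_def power2_eq_square algebra_simps)
    ultimately show ?thesis
      unfolding mult.assoc[of \<eta> d a] using L s pos
      by (intro add_mono diff_mono mult_left_mono mult_right_mono) auto
  qed
  also have "\<dots> = f x - 3/4 * \<eta> * a\<^sup>2 + L * \<eta>\<^sup>2 * (a\<^sup>2 * s) + (\<eta> + L * \<eta>\<^sup>2 * s) * r\<^sup>2"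
    by (simp add: algebra_simps)
  also have "\<dots> \<le> f x - 3/4 * \<eta> * a\<^sup>2 + L * \<eta>\<^sup>2 * (a\<^sup>2 * s)
      + (\<eta> + L * \<eta>\<^sup>2 * s) * (L\<^sup>2 * \<mu>\<^sup>2 / 4 * s\<^sup>2)"
    using r L s pos by (intro add_left_mono mult_left_mono) auto
  also have "\<dots> = f x - 3/4 * \<eta> * a\<^sup>2 + L * \<eta>\<^sup>2 * (a\<^sup>2 * s)
      + \<eta> * \<mu>\<^sup>2 * L\<^sup>2 / 4 * s\<^sup>2 + \<eta>\<^sup>2 * \<mu>\<^sup>2 * L ^ 3 / 4 * s ^ 3"
    by (simp add: algebra_simps power2_eq_square power3_eq_cube)
  finally show ?thesis
    by (simp add: a_def s_def flip: power_mult)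
qed

text \<open>Of the coefficient \<open>3/4\<close> of \<open>\<eta> \<parallel>grad x\<parallel>\<^sup>2\<close>, the term in \<open>(grad x \<bullet> v)\<^sup>2 \<parallel>v\<parallel>\<^sup>2\<close> costs at most
  \<open>1/4\<close>, because \<open>L \<eta> (n + 2) \<le> 1/4\<close> for this step size.  The constant \<open>5/16\<close> is \<open>1/4\<close> from the
  fourth moment plus \<open>1/16\<close> from the sixth.  The integral is taken in the extended nonnegative
  reals, since integrability of the iterates is itself a consequence of this bound; for the same
  reason the decrease stands on the left, where no subtraction is needed.\<close>
lemma expected_step_upper_bound:
  fixes f :: "real^'n \<Rightarrow> real" and x :: "real^'n" and b :: real
  assumes f: "\<And>x. GDERIV f x :> grad x"
    and lip: "L-lipschitz_on UNIV grad"
    and pos: "\<mu> > 0" "L > 0"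
    and lower: "\<And>x. b \<le> f x"
    and \<eta>: "\<eta> = 1 / (4 * (real CARD('n) + 4) * L)"
  shows "(\<integral>\<^sup>+v. ennreal (f (x - \<eta> *\<^sub>R gaussian_oracle (mat 1) \<mu> f x v) - b) \<partial>gaussian_measure)
      + ennreal (\<eta> / 2 * (norm (grad x))\<^sup>2)
    \<le> ennreal (f x - b
         + 5/16 * \<eta> * \<mu>\<^sup>2 * L\<^sup>2 * (real CARD('n) * (real CARD('n) + 2)))"
proof -
  define n where "n = real CARD('n)"
  define R where "R v = f x - b - 3/4 * \<eta> * (grad x \<bullet> v)\<^sup>2 + L * \<eta>\<^sup>2 * ((grad x \<bullet> v)\<^sup>2 * (norm v)\<^sup>2)
        + \<eta> * \<mu>\<^sup>2 * L\<^sup>2 / 4 * norm v ^ 4 + \<eta>\<^sup>2 * \<mu>\<^sup>2 * L ^ 3 / 4 * norm v ^ 6" for v :: "real^'n"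
  define e where "e = f x - b - 3/4 * \<eta> * (norm (grad x))\<^sup>2
        + L * \<eta>\<^sup>2 * ((n + 2) * (norm (grad x))\<^sup>2)
        + \<eta> * \<mu>\<^sup>2 * L\<^sup>2 / 4 * (n * (n + 2)) + \<eta>\<^sup>2 * \<mu>\<^sup>2 * L ^ 3 / 4 * (n * (n + 2) * (n + 4))"
  have n: "n \<ge> 0" by (simp add: n_def)
  have \<eta>_pos: "\<eta> > 0" using pos n by (simp add: \<eta> n_def add_pos_pos)
  have step: "L * \<eta> * (n + 4) = 1 / 4" using pos n by (simp add: \<eta> flip: n_def)
  have const: "has_bochner_integral gaussian_measure (\<lambda>_::real^'n. c) c" for c :: real
    using has_bochner_integral_mult_right[OF has_bochner_integral_monomial[of "\<lambda>_::'n. 0"], of c]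
    by (simp add: monomial_def normal_moment_0)
  have R: "has_bochner_integral gaussian_measure R e"
    unfolding R_def[abs_def] e_def n_def
    by (intro has_bochner_integral_add has_bochner_integral_diff has_bochner_integral_mult_right
        const expectation_inner_sq expectation_inner_sq_norm_sq expectation_norm_pow_4
        expectation_norm_pow_6)
  have le: "f (x - \<eta> *\<^sub>R gaussian_oracle (mat 1) \<mu> f x v) - b \<le> R v" for v
    using oracle_step_upper_bound[OF f lip pos(1), of \<eta> x v] \<eta>_pos by (simp add: R_def)
  have R_nonneg: "0 \<le> R v" for v
    using lower le[of v] by (smt (verit))
  have "(\<integral>\<^sup>+v. ennreal (f (x - \<eta> *\<^sub>R gaussian_oracle (mat 1) \<mu> f x v) - b) \<partial>gaussian_measure)
      \<le> (\<integral>\<^sup>+v. ennreal (R v) \<partial>gaussian_measure)"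
    by (intro nn_integral_mono ennreal_leI le)
  also have "\<dots> = ennreal e"
    using R R_nonneg by (subst nn_integral_eq_integral) (auto simp: has_bochner_integral_iff)
  finally have "(\<integral>\<^sup>+v. ennreal (f (x - \<eta> *\<^sub>R gaussian_oracle (mat 1) \<mu> f x v) - b) \<partial>gaussian_measure)
      + ennreal (\<eta> / 2 * (norm (grad x))\<^sup>2) \<le> ennreal e + ennreal (\<eta> / 2 * (norm (grad x))\<^sup>2)"
    by (intro add_right_mono)
  also have "\<dots> = ennreal (e + \<eta> / 2 * (norm (grad x))\<^sup>2)"
    using \<eta>_pos R R_nonneg
    by (subst ennreal_plus) (auto simp: has_bochner_integral_iff intro: integral_nonneg_AE)
  also have "\<dots> \<le> ennreal (f x - b + 5/16 * \<eta> * \<mu>\<^sup>2 * L\<^sup>2 * (n * (n + 2)))"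
  proof (rule ennreal_leI)
    have "L * \<eta> * (n + 2) \<le> 1 / 4"
      unfolding step[symmetric] using pos \<eta>_pos by (intro mult_left_mono) auto
    then have "(L * \<eta> * (n + 2)) * (\<eta> * (norm (grad x))\<^sup>2) \<le> 1 / 4 * (\<eta> * (norm (grad x))\<^sup>2)"
      using \<eta>_pos by (intro mult_right_mono) auto
    then have quadratic: "L * \<eta>\<^sup>2 * ((n + 2) * (norm (grad x))\<^sup>2) \<le> 1 / 4 * (\<eta> * (norm (grad x))\<^sup>2)"
      by (simp add: power2_eq_square mult_ac)
    have "\<eta>\<^sup>2 * \<mu>\<^sup>2 * L ^ 3 / 4 * (n * (n + 2) * (n + 4))
        = (L * \<eta> * (n + 4)) * (\<eta> * \<mu>\<^sup>2 * L\<^sup>2 / 4 * (n * (n + 2)))"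
      by (simp add: power2_eq_square power3_eq_cube)
    then have sextic: "\<eta>\<^sup>2 * \<mu>\<^sup>2 * L ^ 3 / 4 * (n * (n + 2) * (n + 4))
        = 1 / 4 * (\<eta> * \<mu>\<^sup>2 * L\<^sup>2 / 4 * (n * (n + 2)))"
      unfolding step .
    have "e + \<eta> / 2 * (norm (grad x))\<^sup>2 = f x - b - 1 / 4 * (\<eta> * (norm (grad x))\<^sup>2)
        + L * \<eta>\<^sup>2 * ((n + 2) * (norm (grad x))\<^sup>2)
        + \<eta> * \<mu>\<^sup>2 * L\<^sup>2 / 4 * (n * (n + 2)) + 1 / 4 * (\<eta> * \<mu>\<^sup>2 * L\<^sup>2 / 4 * (n * (n + 2)))"
      unfolding e_def sextic by simp
    also have "\<dots> \<le> f x - b - 1 / 4 * (\<eta> * (norm (grad x))\<^sup>2)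
        + 1 / 4 * (\<eta> * (norm (grad x))\<^sup>2)
        + \<eta> * \<mu>\<^sup>2 * L\<^sup>2 / 4 * (n * (n + 2)) + 1 / 4 * (\<eta> * \<mu>\<^sup>2 * L\<^sup>2 / 4 * (n * (n + 2)))"
      by (intro add_mono quadratic order_refl)
    finally show "e + \<eta> / 2 * (norm (grad x))\<^sup>2
        \<le> f x - b + 5/16 * \<eta> * \<mu>\<^sup>2 * L\<^sup>2 * (n * (n + 2))"
      by (simp add: mult_ac)
  qed
  finally show ?thesis
    by (simp add: n_def)
qed

section \<open>Random iterates and the expected optimality gap\<close>

lemma (in prob_space) distr_gaussian_vector:
  assumes "gaussian_vector M B X"
  shows "distr M borel X = gaussian_measure"
  using assms unfolding gaussian_vector_def distributed_def gaussian_measure_def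
  by (simp cong: distr_cong)

text \<open>The normalised density already fixes the covariance of \<open>X\<close> to be the identity, and the
  covariance is the inverse of \<open>B\<close>.\<close>
lemma (in prob_space) gaussian_vector_identity:
  fixes X :: "'a \<Rightarrow> real^'n"
  assumes X: "gaussian_vector M B X"
  shows "B = mat 1"
proof -
  have [measurable]: "X \<in> borel_measurable M"
    using X by (simp add: gaussian_vector_def distributed_def)
  have "integral\<^sup>L M (\<lambda>\<omega>. X \<omega> $ i * X \<omega> $ j) = (if i = j then 1 else 0)" for i j
  proof -
    have "integral\<^sup>L M (\<lambda>\<omega>. X \<omega> $ i * X \<omega> $ j)
        = integral\<^sup>L (distr M borel X) (\<lambda>v. v $ i * v $ j)"
      by (subst integral_distr) auto
    also have "\<dots> = (if i = j then 1 else 0)"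
      unfolding distr_gaussian_vector[OF X]
      by (rule has_bochner_integral_integral_eq[OF has_bochner_integral_pair])
    finally show ?thesis .
  qed
  then have "(\<chi> i j. integral\<^sup>L M (\<lambda>\<omega>. X \<omega> $ i * X \<omega> $ j)) = (mat 1 :: real^'n^'n)"
    by (simp add: mat_def)
  then have inv: "matrix_inv B = mat 1"
    using X by (simp add: gaussian_vector_def)
  have "invertible B" using X by (simp add: gaussian_vector_def)
  then have "B ** matrix_inv B = mat 1"
    unfolding invertible_def matrix_inv_def by (rule someI2_ex) simp
  then show ?thesis by (simp add: inv)
qed

lemma rand_iterate_restrict:
  "rand_iterate B \<mu> f h x0 (restrict w {..<k}) k = rand_iterate B \<mu> f h x0 w k"
proof -
  have "rand_iterate B \<mu> f h x0 w' j = rand_iterate B \<mu> f h x0 w j"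
    if "\<And>i. i < j \<Longrightarrow> w' i = w i" for w' j
    using that by (induction j) auto
  from this[of k "restrict w {..<k}"] show ?thesis by simp
qed

lemma oracle_step_measurable:
  fixes f :: "real^'n \<Rightarrow> real"
  assumes f: "continuous_on UNIV f"
  shows "(\<lambda>(x, v). x - \<eta> *\<^sub>R gaussian_oracle B \<mu> f x v) \<in> borel_measurable (borel \<Otimes>\<^sub>M borel)"
proof -
  have "continuous_on UNIV (\<lambda>p. fst p - \<eta> *\<^sub>R gaussian_oracle B \<mu> f (fst p) (snd p))"
    unfolding gaussian_oracle_def divide_inverse
    by (intro continuous_intros continuous_on_compose2[OF f]
        continuous_on_compose2[OF matrix_vector_mult_linear_continuous_on[of UNIV B]]) auto
  then show ?thesis
    unfolding borel_prod case_prod_unfold by (rule borel_measurable_continuous_onI)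
qed

lemma rand_iterate_measurable:
  fixes f :: "real^'n \<Rightarrow> real"
  assumes f: "continuous_on UNIV f" and k: "{..<k} \<subseteq> I"
  shows "(\<lambda>w. rand_iterate B \<mu> f h x0 w k) \<in> borel_measurable (Pi\<^sub>M I (\<lambda>_. borel))"
  using k
proof (induction k)
  case (Suc k)
  have "(\<lambda>w. (rand_iterate B \<mu> f h x0 w k, w k)) \<in> measurable (Pi\<^sub>M I (\<lambda>_. borel)) (borel \<Otimes>\<^sub>M borel)"
    using Suc.prems by (intro measurable_Pair Suc.IH measurable_component_singleton) auto
  from measurable_compose[OF this oracle_step_measurable[OF f]]
  show ?case by simp
qed simp

text \<open>Independence turns the joint law into a product, so Tonelli allows integrating out \<open>Y\<close>
  while \<open>X\<close> is held fixed; this replaces conditioning on \<open>X\<close>.\<close>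
lemma (in prob_space) nn_integral_indep_var:
  assumes XY: "indep_var S X T Y" and q: "q \<in> borel_measurable (S \<Otimes>\<^sub>M T)"
  shows "(\<integral>\<^sup>+\<omega>. q (X \<omega>, Y \<omega>) \<partial>M) = (\<integral>\<^sup>+\<omega>. (\<integral>\<^sup>+y. q (X \<omega>, y) \<partial>distr M T Y) \<partial>M)"
proof -
  have [measurable]: "X \<in> measurable M S" "Y \<in> measurable M T"
    using XY by (auto dest: indep_var_rv1 indep_var_rv2)
  note [measurable] = q
  interpret Y: prob_space "distr M T Y" by (rule prob_space_distr) measurable
  have "(\<integral>\<^sup>+\<omega>. q (X \<omega>, Y \<omega>) \<partial>M) = (\<integral>\<^sup>+z. q z \<partial>distr M (S \<Otimes>\<^sub>M T) (\<lambda>\<omega>. (X \<omega>, Y \<omega>)))"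
    by (subst nn_integral_distr) auto
  also have "\<dots> = (\<integral>\<^sup>+z. q z \<partial>(distr M S X \<Otimes>\<^sub>M distr M T Y))"
    using XY by (simp add: indep_var_distribution_eq)
  also have "\<dots> = (\<integral>\<^sup>+x. (\<integral>\<^sup>+y. q (x, y) \<partial>distr M T Y) \<partial>distr M S X)"
    by (subst Y.nn_integral_fst[symmetric]) auto
  also have "\<dots> = (\<integral>\<^sup>+\<omega>. (\<integral>\<^sup>+y. q (X \<omega>, y) \<partial>distr M T Y) \<partial>M)"
    by (subst nn_integral_distr) auto
  finally show ?thesis .
qed

text \<open>The \<open>k\<close>-th iterate is a measurable function of the directions with index below \<open>k\<close>.\<close>
lemma (in prob_space) rand_iterate_indep_direction:
  fixes u :: "nat \<Rightarrow> 'a \<Rightarrow> real^'n"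
  assumes f: "continuous_on UNIV f" and u: "indep_vars (\<lambda>_. borel) u UNIV"
  shows "indep_var borel (\<lambda>\<omega>. rand_iterate B \<mu> f h x0 (\<lambda>i. u i \<omega>) k) borel (u k)"
proof -
  have "indep_var
      borel ((\<lambda>w. rand_iterate B \<mu> f h x0 w k) \<circ> (\<lambda>\<omega>. restrict (\<lambda>i. u i \<omega>) {..<k}))
      borel ((\<lambda>w. w k) \<circ> (\<lambda>\<omega>. restrict (\<lambda>i. u i \<omega>) {k}))"
    using indep_var_restrict[OF u, of "{..<k}" "{k}"]
    by (rule indep_var_compose)
      (auto intro: rand_iterate_measurable[OF f] measurable_component_singleton)
  then show ?thesis by (simp add: comp_def rand_iterate_restrict)
qed

text \<open>The one-step bound is integrated over the law of the \<open>k\<close>-th iterate, after the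
  Polyak-Lojasiewicz inequality has replaced \<open>\<parallel>grad x\<parallel>\<^sup>2 / 2\<close> by \<open>l\<close> times the gap.\<close>
lemma (in prob_space) expected_gap_recursion:
  fixes f :: "real^'n \<Rightarrow> real" and u :: "nat \<Rightarrow> 'a \<Rightarrow> real^'n"
    and x0 :: "real^'n" and b :: real
  assumes f: "\<And>x. GDERIV f x :> grad x"
    and lip: "L-lipschitz_on UNIV grad"
    and pos: "\<mu> > 0" "L > 0" "l > 0"
    and lower: "\<And>x. b \<le> f x"
    and PL: "\<And>x. l * (f x - b) \<le> 1/2 * (norm (grad x))\<^sup>2"
    and u: "indep_vars (\<lambda>_. borel) u UNIV"
    and gauss: "\<And>k. distr M borel (u k) = gaussian_measure"
    and \<eta>: "h k = 1 / (4 * (real CARD('n) + 4) * L)"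
  defines "gap j \<omega> \<equiv> ennreal (f (rand_iterate (mat 1) \<mu> f h x0 (\<lambda>i. u i \<omega>) j) - b)"
  shows "(\<integral>\<^sup>+\<omega>. gap (Suc k) \<omega> \<partial>M) + ennreal (h k * l) * (\<integral>\<^sup>+\<omega>. gap k \<omega> \<partial>M)
    \<le> (\<integral>\<^sup>+\<omega>. gap k \<omega> \<partial>M)
        + ennreal (5/16 * h k * \<mu>\<^sup>2 * L\<^sup>2 * (real CARD('n) * (real CARD('n) + 2)))"
proof -
  define X where "X \<omega> = rand_iterate (mat 1) \<mu> f h x0 (\<lambda>i. u i \<omega>) k" for \<omega>
  define T where "T x v = x - h k *\<^sub>R gaussian_oracle (mat 1) \<mu> f x v" for x v
  define q where "q = (\<lambda>(x, v). ennreal (f (T x v) - b))"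
  define C where "C = 5/16 * h k * \<mu>\<^sup>2 * L\<^sup>2 * (real CARD('n) * (real CARD('n) + 2))"
  have h_pos: "h k > 0" using pos by (simp add: \<eta> add_nonneg_pos)
  have cont: "continuous_on UNIV f"
    by (rule has_derivative_continuous_on) (rule has_derivative_at_withinI[OF f[unfolded gderiv_def]])
  then have f_meas [measurable]: "f \<in> borel_measurable borel"
    by (rule borel_measurable_continuous_onI)
  have indep: "indep_var borel X borel (u k)"
    unfolding X_def[abs_def] by (rule rand_iterate_indep_direction[OF cont u])
  have X_meas [measurable]: "X \<in> borel_measurable M"
    using indep by (rule indep_var_rv1)
  have T_meas [measurable]: "(\<lambda>p. T (fst p) (snd p)) \<in> borel_measurable (borel \<Otimes>\<^sub>M borel)"
    using oracle_step_measurable[OF cont, of "h k" "mat 1" \<mu>] by (simp add: T_def case_prod_unfold)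
  have q_meas: "q \<in> borel_measurable (borel \<Otimes>\<^sub>M borel)"
    unfolding q_def case_prod_unfold by measurable
  have gap_Suc: "gap (Suc k) \<omega> = q (X \<omega>, u k \<omega>)" and gap_k: "gap k \<omega> = ennreal (f (X \<omega>) - b)" for \<omega>
    by (simp_all add: gap_def q_def X_def T_def)
  interpret G: prob_space "gaussian_measure :: (real^'n) measure"
    unfolding gauss[of k, symmetric]
    by (rule prob_space_distr) (rule indep_var_rv2[OF indep])
  have inner_meas: "(\<lambda>x. \<integral>\<^sup>+v. q (x, v) \<partial>gaussian_measure) \<in> borel_measurable borel"
    using q_meas by (intro G.borel_measurable_nn_integral) (simp cong: measurable_cong_sets)
  have step: "(\<integral>\<^sup>+v. q (x, v) \<partial>gaussian_measure) + ennreal (h k * l) * ennreal (f x - b)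
      \<le> ennreal (f x - b) + ennreal C" for x
  proof -
    have "h k * (l * (f x - b)) \<le> h k * (1/2 * (norm (grad x))\<^sup>2)"
      using PL h_pos by (intro mult_left_mono) auto
    then have "ennreal (h k * l) * ennreal (f x - b) \<le> ennreal (h k / 2 * (norm (grad x))\<^sup>2)"
      using lower h_pos pos by (subst ennreal_mult'[symmetric]) (auto intro!: ennreal_leI simp: mult.assoc)
    then have "(\<integral>\<^sup>+v. q (x, v) \<partial>gaussian_measure) + ennreal (h k * l) * ennreal (f x - b)
        \<le> (\<integral>\<^sup>+v. q (x, v) \<partial>gaussian_measure) + ennreal (h k / 2 * (norm (grad x))\<^sup>2)"
      by (rule add_left_mono)
    also have "\<dots> \<le> ennreal (f x - b + C)"
      using expected_step_upper_bound[OF f lip pos(1,2) lower \<eta>, of x]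
      by (simp add: q_def T_def C_def)
    also have "\<dots> = ennreal (f x - b) + ennreal C"
      using lower h_pos by (intro ennreal_plus) (auto simp: C_def)
    finally show ?thesis .
  qed
  have "(\<integral>\<^sup>+\<omega>. gap (Suc k) \<omega> \<partial>M) + ennreal (h k * l) * (\<integral>\<^sup>+\<omega>. gap k \<omega> \<partial>M)
      = (\<integral>\<^sup>+\<omega>. (\<integral>\<^sup>+v. q (X \<omega>, v) \<partial>gaussian_measure) + ennreal (h k * l) * ennreal (f (X \<omega>) - b) \<partial>M)"
    unfolding gap_Suc gap_k nn_integral_indep_var[OF indep q_meas] gauss
    by (subst nn_integral_add)
      (auto simp: nn_integral_cmult intro: measurable_compose[OF X_meas inner_meas])
  also have "\<dots> \<le> (\<integral>\<^sup>+\<omega>. ennreal (f (X \<omega>) - b) + ennreal C \<partial>M)"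
    by (intro nn_integral_mono step)
  also have "\<dots> = (\<integral>\<^sup>+\<omega>. gap k \<omega> \<partial>M) + ennreal C"
    unfolding gap_k by (subst nn_integral_add) (auto simp: emeasure_space_1)
  finally show ?thesis by (simp add: C_def)
qed

lemma sum_le_of_recursion:
  fixes a :: "nat \<Rightarrow> real"
  assumes nonneg: "\<And>k. 0 \<le> a k"
    and recursion: "\<And>k. a (Suc k) + c * a k \<le> a k + C"
  shows "c * (\<Sum>k=0..N. a k) \<le> a 0 + (real N + 1) * C"
proof -
  have "c * (\<Sum>k=0..N. a k) \<le> a 0 - a (Suc N) + (real N + 1) * C" for N
  proof (induction N)
    case (Suc N)
    then show ?case using recursion[of "Suc N"] by (simp add: algebra_simps)
  qed (use recursion[of 0] in simp)
  then show ?thesis using nonneg[of "Suc N"] by (smt (verit))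
qed

theorem theorem1:
  fixes f :: "real^'n \<Rightarrow> real"
    and grad :: "real^'n \<Rightarrow> real^'n"
    and L l \<mu> :: real
    and xstar x0 :: "real^'n"
    and M :: "'w measure"
    and u :: "nat \<Rightarrow> 'w \<Rightarrow> real^'n"
    and B :: "real^'n^'n"
    and h :: "nat \<Rightarrow> real"
    and n N :: nat
    and \<Phi> :: "nat \<Rightarrow> real"
  defines "n \<equiv> CARD('n)"
    and "\<Phi> \<equiv> expected_value M u B \<mu> f h x0"
  assumes gradient: "\<And>x. GDERIV f x :> grad x"
    and L_pos: "L > 0"
    and lipschitz: "L-lipschitz_on UNIV grad"
    and bounded_below: "bdd_below (range f)"
    and minimum: "\<And>x. f xstar \<le> f x"
    and l_pos: "l > 0"
    and PL: "\<And>x. 1/2 * (norm (grad x))\<^sup>2 \<ge> l * (f x - f xstar)"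
    and mu_pos: "\<mu> > 0"
    and prob: "prob_space M"
    and indep: "prob_space.indep_vars M (\<lambda>_. borel) u UNIV"
    and gauss: "\<And>k. gaussian_vector M B (u k)"
    and step: "\<And>k. h k = 1 / (4 * (real n + 4) * L)"
  shows "1 / (real N + 1) * (\<Sum>k=0..N. \<Phi> k - f xstar)
     \<le> 8 * (real n + 4) * L / l *
          ((f x0 - f xstar) / (real N + 1) + 3 * \<mu>\<^sup>2 * (real n + 4) / 32 * L)
        + \<mu>\<^sup>2 / (4 * l) * L\<^sup>2 * (real n + 6) ^ 3"
proof -
  interpret prob_space M by (rule prob)
  define r where "r = real n"
  define \<eta> where "\<eta> = 1 / (4 * (r + 4) * L)"
  define C where "C = 5/16 * \<eta> * \<mu>\<^sup>2 * L\<^sup>2 * (r * (r + 2))"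
  define X where "X k \<omega> = rand_iterate (mat 1) \<mu> f h x0 (\<lambda>i. u i \<omega>) k" for k \<omega>
  define E where "E k = (\<integral>\<^sup>+\<omega>. ennreal (f (X k \<omega>) - f xstar) \<partial>M)" for k
  have r: "r \<ge> 0" by (simp add: r_def)
  have h: "h k = \<eta>" for k by (simp add: step \<eta>_def r_def)
  have \<eta>_pos: "\<eta> > 0" using L_pos r by (simp add: \<eta>_def)
  have C: "C \<ge> 0" using \<eta>_pos r by (simp add: C_def)
  have B: "B = mat 1" by (rule gaussian_vector_identity[OF gauss])
  have rec: "E (Suc k) + ennreal (\<eta> * l) * E k \<le> E k + ennreal C" for k
    using expected_gap_recursion[OF gradient lipschitz mu_pos L_pos l_pos minimum PL indep
        distr_gaussian_vector[OF gauss], of h k x0] step[of k]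
    by (simp add: E_def X_def C_def r_def n_def h)
  have E0: "E 0 = ennreal (f x0 - f xstar)"
    by (simp add: E_def X_def emeasure_space_1)
  \<comment> \<open>Finiteness propagates along the recursion and makes the Bochner integrals meaningful.\<close>
  have fin: "E k < \<infinity>" for k
  proof (induction k)
    case (Suc k)
    have "E (Suc k) \<le> E (Suc k) + ennreal (\<eta> * l) * E k" by simp
    also note rec[of k]
    also have "E k + ennreal C < \<infinity>" using Suc by (simp add: less_top)
    finally show ?case .
  qed (simp add: E0)
  have cont: "continuous_on UNIV f"
    by (rule has_derivative_continuous_on) (rule has_derivative_at_withinI[OF gradient[unfolded gderiv_def]])
  have [measurable]: "f \<in> borel_measurable borel"
    using cont by (rule borel_measurable_continuous_onI)
  have [measurable]: "X k \<in> borel_measurable M" for k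
    unfolding X_def by (rule indep_var_rv1[OF rand_iterate_indep_direction[OF cont indep]])
  define a where "a k = (LINT \<omega>|M. f (X k \<omega>) - f xstar)" for k
  have int: "integrable M (\<lambda>\<omega>. f (X k \<omega>) - f xstar)" for k
    using fin[of k] minimum by (intro integrableI_nonneg) (auto simp: E_def)
  have E_a: "E k = ennreal (a k)" for k
    unfolding E_def a_def using minimum int by (intro nn_integral_eq_integral) auto
  have a_nonneg: "a k \<ge> 0" for k
    unfolding a_def using minimum by (intro integral_nonneg_AE) auto
  have \<Phi>: "\<Phi> k - f xstar = a k" for k
  proof (cases k)
    case 0
    then show ?thesis by (simp add: \<Phi>_def expected_value_def a_def X_def prob_space)
  next
    case (Suc j)
    have "integrable M (\<lambda>\<omega>. (f (X k \<omega>) - f xstar) + f xstar)"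
      using int by (intro Bochner_Integration.integrable_add) auto
    then have "a k = (LINT \<omega>|M. f (X k \<omega>)) - f xstar"
      by (simp add: a_def prob_space)
    with Suc show ?thesis by (simp add: \<Phi>_def expected_value_def X_def B)
  qed
  have "a (Suc k) + (\<eta> * l) * a k \<le> a k + C" for k
    using rec[of k] a_nonneg C \<eta>_pos l_pos
    by (simp add: E_a flip: ennreal_mult' ennreal_plus)
  from sum_le_of_recursion[of a, OF a_nonneg this, of N]
  have sum: "\<eta> * l * (\<Sum>k=0..N. a k) \<le> a 0 + (real N + 1) * C" .
  have a0: "a 0 = f x0 - f xstar" using E0 E_a[of 0] a_nonneg[of 0] minimum by simp
  define D where "D = (f x0 - f xstar) / (real N + 1)"
  have D: "D \<ge> 0" using minimum by (simp add: D_def)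
  have "\<eta> * l * (1 / (real N + 1) * (\<Sum>k=0..N. a k)) \<le> D + C"
    using sum by (simp add: D_def a0 divide_simps) (simp add: algebra_simps)
  then have "1 / (real N + 1) * (\<Sum>k=0..N. a k) \<le> (D + C) / (\<eta> * l)"
    using \<eta>_pos l_pos by (simp add: pos_le_divide_eq mult_ac)
  also have "\<dots> = 4 * (r + 4) * L / l * D + \<mu>\<^sup>2 * L\<^sup>2 / l * (5/16 * (r * (r + 2)))"
  proof -
    have "C / (\<eta> * l) = \<mu>\<^sup>2 * L\<^sup>2 / l * (5/16 * (r * (r + 2)))"
      using \<eta>_pos l_pos by (simp add: C_def field_simps)
    moreover have "D / (\<eta> * l) = 4 * (r + 4) * L / l * D"
      by (simp add: \<eta>_def)
    ultimately show ?thesis by (simp add: add_divide_distrib)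
  qed
  \<comment> \<open>The claim with its bracket expanded: the summands \<open>3/4 (r + 4)\<^sup>2\<close> and \<open>(r + 6)\<^sup>3 / 4\<close> come from the
    two \<open>\<mu>\<^sup>2\<close>-terms of the bound.\<close>
  also have "\<dots> \<le> 8 * (r + 4) * L / l * D + \<mu>\<^sup>2 * L\<^sup>2 / l * (3/4 * (r + 4)\<^sup>2 + (r + 6) ^ 3 / 4)"
  proof (intro add_mono mult_left_mono mult_right_mono divide_right_mono)
    have "0 \<le> r * r" "0 \<le> r * (r * r)" using r by auto
    then show "5/16 * (r * (r + 2)) \<le> 3/4 * (r + 4)\<^sup>2 + (r + 6) ^ 3 / 4"
      using r by (simp add: power2_eq_square power3_eq_cube algebra_simps)
  qed (use r D L_pos l_pos in auto)
  also have "\<dots> = 8 * (r + 4) * L / l * (D + 3 * \<mu>\<^sup>2 * (r + 4) / 32 * L)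
        + \<mu>\<^sup>2 / (4 * l) * L\<^sup>2 * (r + 6) ^ 3"
    by (simp add: algebra_simps add_divide_distrib power2_eq_square)
  finally show ?thesis
    by (simp add: \<Phi> D_def r_def)
qed

end
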